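(* Let $n>3$ be odd and let $m$ be a positive integer with $m<n$, $\gcd(m,n)=1$ and $\gcd(m-1,n)=1$. Let $\langle L_n(m)\cup I\rangle$ be the associated neutrosophic loop. For every positive divisor $t$ of $n$, writing $k=n/t$, there exist $t$ neutrosophic subloops of $\langle L_n(m)\cup I\rangle$ of order $2(k+1)$.
   Context: For $n>3$ odd and $m<n$ a positive integer with $\gcd(m,n)=\gcd(m-1,n)=1$, the loop $L_n(m)$ is the set $\{e,1,2,\dots,n\}$ with operation: $e\cdot i=i\cdot e=i$ for all $i$; $i\cdot i=e$ for all $i$; and for $i,j\in\{1,\dots,n\}$, $i\neq j$, $i\cdot j$ is the element $s\in\{1,\dots,n\}$ with $s\equiv mj-(m-1)i \pmod n$. The neutrosophic loop $\langle L_n(m)\cup I\rangle$ is the set $\{e,1,\dots,n,eI,1I,\dots,nI\}$ of $2(n+1)$ distinct symbols, with the product of $L_n(m)$ on $\{e,1,\dots,n\}$ and $x\cdot(yI)=(xI)\cdot y=(xI)\cdot(yI)=(x\cdot y)I$ for $x,y\in L_n(m)$ ($I$ is an indeterminate with $I^2=I$). A neutrosophic subloop is a subset of the form $P\cup\{xI: x\in P\}$, where $P$ is a subloop of $L_n(m)$; the whole $\langle L_n(m)\cup I\rangle$ is allowed. The order is the number of elements. *)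

theory Defs
  imports "HOL-Algebra.Group" "HOL-Number_Theory.Cong"
begin

(* Loops in the quasigroup sense, over the record type of HOL-Algebra. That type is called monoid,
   but it only bundles carrier, product and unit; associativity is not assumed. *)
locale loop =
  fixes G (structure)
  assumes mult_closed: "\<lbrakk>x \<in> carrier G; y \<in> carrier G\<rbrakk> \<Longrightarrow> x \<otimes> y \<in> carrier G"
    and one_closed: "\<one> \<in> carrier G"
    and left_one: "x \<in> carrier G \<Longrightarrow> \<one> \<otimes> x = x"
    and right_one: "x \<in> carrier G \<Longrightarrow> x \<otimes> \<one> = x"
    and left_division: "\<lbrakk>a \<in> carrier G; b \<in> carrier G\<rbrakk> \<Longrightarrow> \<exists>!x. x \<in> carrier G \<and> a \<otimes> x = b"
    and right_division: "\<lbrakk>a \<in> carrier G; b \<in> carrier G\<rbrakk> \<Longrightarrow> \<exists>!x. x \<in> carrier G \<and> x \<otimes> a = b"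

definition subloop :: "'a set \<Rightarrow> ('a, 'b) monoid_scheme \<Rightarrow> bool" where
  "subloop P G \<longleftrightarrow> P \<subseteq> carrier G \<and> loop (G\<lparr>carrier := P\<rparr>)"

datatype lelem = Unit | Num nat

fun L_mult :: "nat \<Rightarrow> nat \<Rightarrow> lelem \<Rightarrow> lelem \<Rightarrow> lelem" where
  "L_mult n m Unit y = y"
| "L_mult n m (Num i) Unit = Num i"
| "L_mult n m (Num i) (Num j) =
     (if i = j then Unit
      else Num (THE s. s \<in> {1..n} \<and> [int s = int m * int j - (int m - 1) * int i] (mod int n)))"

definition L_loop :: "nat \<Rightarrow> nat \<Rightarrow> lelem monoid" where
  "L_loop n m = \<lparr>carrier = insert Unit (Num ` {1..n}), monoid.mult = L_mult n m, one = Unit\<rparr>"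

(* Plain x is the element x itself and Indet x is the symbol xI. *)
datatype 'a neutro = Plain 'a | Indet 'a

fun neutro_mult :: "('a \<Rightarrow> 'a \<Rightarrow> 'a) \<Rightarrow> 'a neutro \<Rightarrow> 'a neutro \<Rightarrow> 'a neutro" where
  "neutro_mult f (Plain x) (Plain y) = Plain (f x y)"
| "neutro_mult f (Plain x) (Indet y) = Indet (f x y)"
| "neutro_mult f (Indet x) (Plain y) = Indet (f x y)"
| "neutro_mult f (Indet x) (Indet y) = Indet (f x y)"

(* The structure generated by G and the indeterminate I with I * I = I. *)
definition neutrosophic :: "('a, 'b) monoid_scheme \<Rightarrow> 'a neutro monoid" where
  "neutrosophic G = \<lparr>carrier = Plain ` carrier G \<union> Indet ` carrier G,
     monoid.mult = neutro_mult (monoid.mult G), one = Plain (one G)\<rparr>"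

(* N is a neutrosophic subloop of neutrosophic G: it has the form P \<union> {xI : x \<in> P} for a
   subloop P of G, with P = carrier G allowed. *)
definition neutrosophic_subloop :: "'a neutro set \<Rightarrow> ('a, 'b) monoid_scheme \<Rightarrow> bool" where
  "neutrosophic_subloop N G \<longleftrightarrow>
     (\<exists>P. subloop P G \<and> N = carrier (neutrosophic (G\<lparr>carrier := P\<rparr>)))"

end

theory Submission
  imports Defs
begin

text \<open>
  The \<open>t\<close> subloops come from the residue classes modulo \<open>t\<close>. If \<open>i\<close> and \<open>j\<close> are both congruent to
  \<open>r\<close> modulo \<open>t\<close>, then so is \<open>m j - (m - 1) i\<close>, because the coefficients \<open>m\<close> and \<open>-(m - 1)\<close> add up
  to \<open>1\<close>; and as \<open>t\<close> divides \<open>n\<close>, reducing this number modulo \<open>n\<close> does not change its class modulo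
  \<open>t\<close>. A residue class together with the unit is therefore closed under the product
  (\<open>L_mult_residue_class_closed\<close>).

  Closure is all that has to be checked. The coprimality of \<open>m\<close> and of \<open>m - 1\<close> with \<open>n\<close> makes
  both kinds of translation of \<open>L\<^sub>n(m)\<close> injective (\<open>L_mult_left_cancel\<close>, \<open>L_mult_right_cancel\<close>), and
  an injective self-map of a finite set is bijective, so division is possible inside every
  closed subset that contains the unit (\<open>finite_cancellative_loop\<close>).

  The \<open>t\<close> classes have \<open>n / t\<close> elements each and are pairwise distinct; adjoining the unit and
  doubling by the indeterminate gives neutrosophic subloops of order \<open>2 (n / t + 1)\<close>.
\<close>

section \<open>Finite cancellative structures with unit\<close>

lemma finite_inj_on_ex1_preimage:
  assumes "finite A" and "inj_on f A" and "f ` A \<subseteq> A" and "b \<in> A"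
  shows "\<exists>!x. x \<in> A \<and> f x = b"
proof -
  have "f ` A = A"
    using assms(1,3,2) by (rule endo_inj_surj)
  with assms(2,4) show ?thesis
    by (metis imageE inj_onD)
qed

lemma finite_cancellative_loop:
  fixes G (structure)
  assumes "finite (carrier G)"
    and "\<And>x y. \<lbrakk>x \<in> carrier G; y \<in> carrier G\<rbrakk> \<Longrightarrow> x \<otimes> y \<in> carrier G"
    and "\<one> \<in> carrier G"
    and "\<And>x. x \<in> carrier G \<Longrightarrow> \<one> \<otimes> x = x"
    and "\<And>x. x \<in> carrier G \<Longrightarrow> x \<otimes> \<one> = x"
    and "\<And>a. a \<in> carrier G \<Longrightarrow> inj_on (\<lambda>x. a \<otimes> x) (carrier G)"
    and "\<And>a. a \<in> carrier G \<Longrightarrow> inj_on (\<lambda>x. x \<otimes> a) (carrier G)"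
  shows "loop G"
proof
  fix a b
  assume "a \<in> carrier G" "b \<in> carrier G"
  with assms show "\<exists>!x. x \<in> carrier G \<and> a \<otimes> x = b"
    by (intro finite_inj_on_ex1_preimage) auto
next
  fix a b
  assume "a \<in> carrier G" "b \<in> carrier G"
  with assms show "\<exists>!x. x \<in> carrier G \<and> x \<otimes> a = b"
    by (intro finite_inj_on_ex1_preimage) auto
qed (use assms in auto)

section \<open>Residues in the range from 1 to n\<close>

lemma cong_imp_eq_1_to_n:
  fixes n i j :: nat
  assumes "[int i = int j] (mod int n)" and "i \<in> {1..n}" and "j \<in> {1..n}"
  shows "i = j"
proof -
  have "[int i - 1 = int j - 1] (mod int n)"
    using assms(1) by (intro cong_diff) auto
  then have "int i - 1 = int j - 1"
    by (rule cong_less_imp_eq_int[rotated 4]) (use assms(2,3) in auto)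
  then show ?thesis by simp
qed

lemma ex1_residue_1_to_n:
  fixes n :: nat and z :: int
  assumes "n > 0"
  shows "\<exists>!s. s \<in> {1..n} \<and> [int s = z] (mod int n)"
proof (rule ex_ex1I)
  \<comment> \<open>The shift by one makes the multiples of \<open>n\<close> be represented by \<open>n\<close> instead of \<open>0\<close>.\<close>
  define s where "s = nat ((z - 1) mod int n) + 1"
  have bounds: "0 \<le> (z - 1) mod int n" "(z - 1) mod int n < int n"
    using assms by simp_all
  then have "int s = (z - 1) mod int n + 1"
    by (simp add: s_def)
  moreover have "[(z - 1) mod int n + 1 = (z - 1) + 1] (mod int n)"
    by (intro cong_add) simp_all
  ultimately have "[int s = z] (mod int n)"
    by simp
  moreover have "s \<in> {1..n}"
    using bounds by (auto simp: s_def)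
  ultimately show "\<exists>s. s \<in> {1..n} \<and> [int s = z] (mod int n)"
    by blast
next
  fix s s'
  assume "s \<in> {1..n} \<and> [int s = z] (mod int n)" "s' \<in> {1..n} \<and> [int s' = z] (mod int n)"
  then show "s = s'"
    by (metis cong_imp_eq_1_to_n cong_sym cong_trans)
qed

definition residue_class :: "nat \<Rightarrow> nat \<Rightarrow> nat \<Rightarrow> nat set" where
  "residue_class n t r = {i \<in> {1..n}. [int i = int r] (mod int t)}"

lemma card_residue_class:
  fixes n t r :: nat
  assumes "t dvd n" and "r \<in> {1..t}"
  shows "card (residue_class n t r) = n div t"
proof -
  obtain k where n: "n = t * k"
    using assms(1) by blast
  have "residue_class n t r = (\<lambda>q. r + t * q) ` {..<k}"
  proof (intro equalityI subsetI)
    fix i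
    assume "i \<in> residue_class n t r"
    then have i: "i \<in> {1..n}" "[i = r] (mod t)"
      by (simp_all add: residue_class_def cong_int_iff)
    have "r \<le> i"
    proof (rule ccontr)
      assume "\<not> r \<le> i"
      then have "i = r"
        by (intro cong_imp_eq_1_to_n[of i r t]) (use i assms(2) in \<open>auto simp: cong_int_iff\<close>)
      with \<open>\<not> r \<le> i\<close> show False by simp
    qed
    then have "t dvd i - r"
      using i(2) by (simp add: cong_altdef_nat)
    then obtain q where q: "i = r + t * q"
      using \<open>r \<le> i\<close> by (metis dvdE le_add_diff_inverse)
    \<comment> \<open>As \<open>r\<close> is positive, the value \<open>q = k\<close> would give an element above \<open>n\<close>.\<close>
    have "t * q < t * k"
      using i(1) assms(2) unfolding q n atLeastAtMost_iff by linarith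
    then show "i \<in> (\<lambda>q. r + t * q) ` {..<k}"
      by (simp add: q)
  next
    fix i
    assume "i \<in> (\<lambda>q. r + t * q) ` {..<k}"
    then obtain q where q: "i = r + t * q" "q < k"
      by blast
    have "t * Suc q \<le> t * k"
      using q(2) by (intro mult_le_mono2 Suc_leI)
    then have "i \<le> n"
      using assms(2) by (simp add: q n)
    moreover have "[i = r] (mod t)"
      by (simp add: q cong_def)
    ultimately show "i \<in> residue_class n t r"
      using assms(2) q(1) by (simp add: residue_class_def cong_int_iff)
  qed
  moreover have "inj_on (\<lambda>q. r + t * q) {..<k}"
    using assms(2) by (intro inj_onI) simp
  ultimately show ?thesis
    using assms(2) by (simp add: card_image n)
qed

lemma inj_on_residue_class:
  assumes "t \<le> n"
  shows "inj_on (residue_class n t) {1..t}"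
proof (rule inj_onI)
  fix r r'
  assume r: "r \<in> {1..t}" "r' \<in> {1..t}" and eq: "residue_class n t r = residue_class n t r'"
  have "r \<in> residue_class n t r"
    using r(1) assms by (simp add: residue_class_def)
  then have "[int r = int r'] (mod int t)"
    unfolding eq by (simp add: residue_class_def)
  then show "r = r'"
    using r by (rule cong_imp_eq_1_to_n)
qed

section \<open>Products in the loop\<close>

lemma L_mult_Num_distinct:
  fixes n m i j :: nat
  assumes "n > 0" and "i \<noteq> j"
  obtains s where "L_mult n m (Num i) (Num j) = Num s" and "s \<in> {1..n}"
    and "[int s = int m * int j - (int m - 1) * int i] (mod int n)"
  using theI'[OF ex1_residue_1_to_n[OF assms(1), of "int m * int j - (int m - 1) * int i"]] assms(2)
  by auto

text \<open>
  In \<open>m j - (m - 1) i\<close> each factor is multiplied by a unit modulo \<open>n\<close>, so products of distinct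
  numbers determine either factor from the other. The two exceptional rules of the product cause no
  collision: a square is the unit and not a number, and a product with the unit returns the other
  factor, whereas \<open>i \<cdot> j = i\<close> would give \<open>m i = m j\<close> modulo \<open>n\<close>, and \<open>i \<cdot> j = j\<close> would give
  \<open>(m - 1) i = (m - 1) j\<close>, both impossible for distinct \<open>i\<close> and \<open>j\<close>.
\<close>

lemma L_mult_left_cancel:
  fixes n m :: nat
  assumes "n > 0" and "coprime m n"
    and "a \<in> carrier (L_loop n m)"
  shows "inj_on (L_mult n m a) (carrier (L_loop n m))"
proof (cases a)
  case Unit
  then show ?thesis by (auto intro: inj_onI)
next
  case (Num i)
  with assms(3) have i: "i \<in> {1..n}"
    by (auto simp: L_loop_def)
  have coprime: "coprime (int m) (int n)"
    using assms(2) by simp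
  have ne_i: "L_mult n m (Num i) (Num j) \<noteq> Num i" if "j \<in> {1..n}" for j
  proof
    assume eq: "L_mult n m (Num i) (Num j) = Num i"
    then have "i \<noteq> j" by auto
    with assms(1) eq have "[int i = int m * int j - (int m - 1) * int i] (mod int n)"
      by (metis L_mult_Num_distinct lelem.inject)
    from cong_add[OF this cong_refl[of "(int m - 1) * int i"]]
    have "[int m * int i = int m * int j] (mod int n)"
      by (simp add: algebra_simps)
    then have "[int i = int j] (mod int n)"
      using coprime by (simp add: cong_mult_lcancel)
    with i that \<open>i \<noteq> j\<close> show False
      by (metis cong_imp_eq_1_to_n)
  qed
  have inj_Num: "j = j'"
    if "j \<in> {1..n}" "j' \<in> {1..n}" and eq: "L_mult n m (Num i) (Num j) = L_mult n m (Num i) (Num j')"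
    for j j'
  proof (cases "i = j \<or> i = j'")
    case True
    with eq show ?thesis
      by (auto split: if_splits)
  next
    case False
    then obtain s where "[int s = int m * int j - (int m - 1) * int i] (mod int n)"
        "[int s = int m * int j' - (int m - 1) * int i] (mod int n)"
      using eq assms(1) by (metis L_mult_Num_distinct lelem.inject)
    then have "[int m * int j - (int m - 1) * int i = int m * int j' - (int m - 1) * int i] (mod int n)"
      by (metis cong_sym cong_trans)
    from cong_add[OF this cong_refl[of "(int m - 1) * int i"]]
    have "[int j = int j'] (mod int n)"
      using coprime by (simp add: cong_mult_lcancel)
    then show ?thesis
      using that(1,2) by (rule cong_imp_eq_1_to_n)
  qed
  show ?thesis
  proof (rule inj_onI)
    fix x y
    assume "x \<in> carrier (L_loop n m)" "y \<in> carrier (L_loop n m)" "L_mult n m a x = L_mult n m a y"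
    then have "x = Unit \<or> (\<exists>k\<in>{1..n}. x = Num k)" "y = Unit \<or> (\<exists>k\<in>{1..n}. y = Num k)"
        "L_mult n m (Num i) x = L_mult n m (Num i) y"
      by (auto simp: L_loop_def Num)
    then show "x = y"
      by (metis L_mult.simps(2) ne_i inj_Num)
  qed
qed

lemma L_mult_right_cancel:
  fixes n m :: nat
  assumes "n > 0" and "m > 0" and "coprime (m - 1) n"
    and "a \<in> carrier (L_loop n m)"
  shows "inj_on (\<lambda>x. L_mult n m x a) (carrier (L_loop n m))"
proof (cases a)
  case Unit
  have "L_mult n m x Unit = x" for x
    by (cases x) auto
  with Unit show ?thesis by (auto intro: inj_onI)
next
  case (Num j)
  with assms(4) have j: "j \<in> {1..n}"
    by (auto simp: L_loop_def)
  have coprime: "coprime (int m - 1) (int n)"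
    using assms(2,3) by (metis One_nat_def Suc_leI coprime_int_iff of_nat_1 of_nat_diff)
  have ne_j: "L_mult n m (Num i) (Num j) \<noteq> Num j" if "i \<in> {1..n}" for i
  proof
    assume eq: "L_mult n m (Num i) (Num j) = Num j"
    then have "i \<noteq> j" by auto
    with assms(1) eq have "[int j = int m * int j - (int m - 1) * int i] (mod int n)"
      by (metis L_mult_Num_distinct lelem.inject)
    from cong_add[OF this cong_refl[of "(int m - 1) * int i - int j"]]
    have "[(int m - 1) * int i = (int m - 1) * int j] (mod int n)"
      by (simp add: algebra_simps)
    then have "[int i = int j] (mod int n)"
      using coprime by (simp add: cong_mult_lcancel)
    with j that \<open>i \<noteq> j\<close> show False
      by (metis cong_imp_eq_1_to_n)
  qed
  have inj_Num: "i = i'"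
    if "i \<in> {1..n}" "i' \<in> {1..n}" and eq: "L_mult n m (Num i) (Num j) = L_mult n m (Num i') (Num j)"
    for i i'
  proof (cases "i = j \<or> i' = j")
    case True
    with eq show ?thesis
      by (auto split: if_splits)
  next
    case False
    then obtain s where "[int s = int m * int j - (int m - 1) * int i] (mod int n)"
        "[int s = int m * int j - (int m - 1) * int i'] (mod int n)"
      using eq assms(1) by (metis L_mult_Num_distinct lelem.inject)
    then have "[int m * int j - (int m - 1) * int i = int m * int j - (int m - 1) * int i'] (mod int n)"
      by (metis cong_sym cong_trans)
    from cong_diff[OF cong_refl[of "int m * int j"] this]
    have "[int i = int i'] (mod int n)"
      using coprime by (simp add: cong_mult_lcancel)
    then show ?thesis
      using that(1,2) by (rule cong_imp_eq_1_to_n)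
  qed
  show ?thesis
  proof (rule inj_onI)
    fix x y
    assume "x \<in> carrier (L_loop n m)" "y \<in> carrier (L_loop n m)" "L_mult n m x a = L_mult n m y a"
    then have "x = Unit \<or> (\<exists>k\<in>{1..n}. x = Num k)" "y = Unit \<or> (\<exists>k\<in>{1..n}. y = Num k)"
        "L_mult n m x (Num j) = L_mult n m y (Num j)"
      by (auto simp: L_loop_def Num)
    then show "x = y"
      by (metis L_mult.simps(1) ne_j inj_Num)
  qed
qed

section \<open>Subloops from residue classes\<close>

definition class_carrier :: "nat \<Rightarrow> nat \<Rightarrow> nat \<Rightarrow> lelem set" where
  "class_carrier n t r = insert Unit (Num ` residue_class n t r)"

lemma L_mult_residue_class_closed:
  fixes n m t r :: nat
  assumes "n > 0" and "t dvd n"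
    and "x \<in> class_carrier n t r" and "y \<in> class_carrier n t r"
  shows "L_mult n m x y \<in> class_carrier n t r"
proof (cases "\<exists>i j. x = Num i \<and> y = Num j \<and> i \<noteq> j")
  case True
  then obtain i j where xy: "x = Num i" "y = Num j" "i \<noteq> j" by blast
  with assms(3,4) have ij: "[int i = int r] (mod int t)" "[int j = int r] (mod int t)"
    by (auto simp: class_carrier_def residue_class_def)
  obtain s where s: "L_mult n m x y = Num s" "s \<in> {1..n}"
    "[int s = int m * int j - (int m - 1) * int i] (mod int n)"
    using L_mult_Num_distinct[OF assms(1) xy(3)] xy(1,2) by metis
  from s(3) have "[int s = int m * int j - (int m - 1) * int i] (mod int t)"
    by (rule cong_dvd_modulus) (use assms(2) in simp)
  also have "[int m * int j - (int m - 1) * int i = int m * int r - (int m - 1) * int r] (mod int t)"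
    using ij by (intro cong_diff cong_mult cong_refl)
  also have "int m * int r - (int m - 1) * int r = int r"
    by (simp add: algebra_simps)
  finally show ?thesis
    using s by (simp add: class_carrier_def residue_class_def)
next
  case False
  with assms(3,4) show ?thesis
    by (cases x; cases y) (auto simp: class_carrier_def)
qed

lemma subloop_class_carrier:
  fixes n m t r :: nat
  assumes "n > 0" and "m > 0" and "coprime m n" and "coprime (m - 1) n" and "t dvd n"
  shows "subloop (class_carrier n t r) (L_loop n m)"
proof -
  have sub: "class_carrier n t r \<subseteq> carrier (L_loop n m)"
    by (auto simp: class_carrier_def residue_class_def L_loop_def)
  have "loop (L_loop n m\<lparr>carrier := class_carrier n t r\<rparr>)"
  proof (rule finite_cancellative_loop, goal_cases)
    case 1
    show ?case
      by (simp add: class_carrier_def residue_class_def)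
  next
    case (2 x y)
    with assms show ?case
      by (simp add: L_loop_def L_mult_residue_class_closed)
  next
    case 3
    show ?case
      by (simp add: L_loop_def class_carrier_def)
  next
    case (4 x)
    show ?case
      by (simp add: L_loop_def)
  next
    case (5 x)
    show ?case
      by (cases x) (simp_all add: L_loop_def)
  next
    case (6 a)
    with sub have "inj_on (L_mult n m a) (class_carrier n t r)"
      by (intro inj_on_subset[OF L_mult_left_cancel[OF assms(1,3)]]) auto
    then show ?case
      by (simp add: L_loop_def)
  next
    case (7 a)
    with sub have "inj_on (\<lambda>x. L_mult n m x a) (class_carrier n t r)"
      by (intro inj_on_subset[OF L_mult_right_cancel[OF assms(1,2,4)]]) auto
    then show ?case
      by (simp add: L_loop_def)
  qed
  with sub show ?thesis
    by (simp add: subloop_def)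
qed

lemma card_neutrosophic_carrier:
  assumes "finite (carrier G)"
  shows "card (carrier (neutrosophic G)) = 2 * card (carrier G)"
proof -
  have "card (Plain ` carrier G \<union> Indet ` carrier G)
      = card (Plain ` carrier G) + card (Indet ` carrier G)"
    using assms by (intro card_Un_disjoint) auto
  also have "\<dots> = 2 * card (carrier G)"
    by (simp add: card_image inj_on_def)
  finally show ?thesis
    by (simp add: neutrosophic_def)
qed

theorem theorem4p1p1:
  fixes n m t :: nat
  assumes "n > 3" and "odd n"
    and "0 < m" and "m < n" and "coprime m n" and "coprime (m - 1) n"
    and "t > 0" and "t dvd n"
  shows "\<exists>\<S>. card \<S> = t \<and>
    (\<forall>N\<in>\<S>. neutrosophic_subloop N (L_loop n m) \<and> card N = 2 * (n div t + 1))"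
proof -
  define N where "N r = carrier (neutrosophic (L_loop n m\<lparr>carrier := class_carrier n t r\<rparr>))" for r
  have "t \<le> n"
    using assms(1,8) by (intro dvd_imp_le) auto
  have "inj_on N {1..t}"
  proof (rule inj_onI)
    fix r r'
    assume r: "r \<in> {1..t}" "r' \<in> {1..t}" and eq: "N r = N r'"
    \<comment> \<open>The plain elements other than the unit recover the residue class.\<close>
    have "residue_class n t q = {i. Plain (Num i) \<in> N q}" for q
      by (auto simp: N_def neutrosophic_def class_carrier_def)
    with eq have "residue_class n t r = residue_class n t r'"
      by simp
    with r inj_on_residue_class[OF \<open>t \<le> n\<close>] show "r = r'"
      by (auto dest: inj_onD)
  qed
  then have "card (N ` {1..t}) = t"
    by (simp add: card_image)
  moreover have "neutrosophic_subloop (N r) (L_loop n m)" for r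
    using subloop_class_carrier[OF _ assms(3,5,6,8), of r] assms(1)
    unfolding neutrosophic_subloop_def N_def by auto
  moreover have "card (N r) = 2 * (n div t + 1)" if "r \<in> {1..t}" for r
  proof -
    have "finite (residue_class n t r)"
      by (simp add: residue_class_def)
    moreover have "card (Num ` residue_class n t r) = n div t"
      using card_residue_class[OF assms(8) that] by (simp add: card_image inj_on_def)
    moreover have "Unit \<notin> Num ` residue_class n t r"
      by auto
    ultimately show ?thesis
      by (simp add: N_def card_neutrosophic_carrier class_carrier_def)
  qed
  ultimately show ?thesis
    by (intro exI[of _ "N ` {1..t}"]) auto
qed

end
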